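(* Let $\tilde{P} \subset \mathbb{R}^k$ ($k \geq 1$) be a non-empty polytope, let $\tilde{x} \in \mathbb{R}^k$, and let $f(y) = \tfrac{1}{2}\lVert y - \tilde{x}\rVert^2$. Let $(y_t)_{t \geq 0}$ be the sequence of iterates of a Frank-Wolfe method applied to $\min_{y \in \tilde{P}} f(y)$; that is, $y_t \in \tilde{P}$ for all $t \ge 0$, and the Frank-Wolfe gaps $\max_{v \in \tilde{P}} \langle y_t - \tilde{x}, y_t - v\rangle$ converge to $0$ as $t \to \infty$. Then the following are equivalent: 1. (Non-Membership) $\tilde{x} \notin \tilde{P}$. 2. (Distance) There exists an iteration $t$ such that $\lVert y_t - v\rVert < \lVert \tilde{x} - v\rVert$ for all vertices $v$ of $\tilde{P}$. 3. (FW Gap) For some iteration $t$, $\max_{v \in \tilde{P}} \langle y_t - \tilde{x}, y_t - v\rangle < \tfrac{1}{2}\lVert \tilde{x} - y_t\rVert^2$.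
   Context: A polytope is a bounded polyhedron, equivalently the convex hull of finitely many points. $\langle\cdot,\cdot\rangle$ is the standard inner product and $\lVert\cdot\rVert$ the Euclidean norm on $\mathbb{R}^k$. The gradient of $f$ is $\nabla f(y) = y - \tilde{x}$, and the Frank-Wolfe gap at a point $y \in \tilde{P}$ is $\max_{v\in\tilde{P}} \langle \nabla f(y), y - v\rangle$. The original Frank-Wolfe algorithm starts from some $y_0 \in \tilde{P}$ and, in each iteration $t \geq 0$, computes $v_t \in \operatorname{argmin}_{v \in \tilde{P}} \langle \nabla f(y_t), v\rangle$ and sets $y_{t+1} = y_t + \gamma_t (v_t - y_t)$ with step size $\gamma_t > 0$; a common choice is $\gamma_t = \frac{2}{t+2}$. Variants of this algorithm (other step-size rules, away steps, lazification) are also allowed. The properties of the method that are used are that all iterates lie in $\tilde{P}$ and that the Frank-Wolfe gap converges to $0$ as the algorithm progresses. The algorithm is considered as running indefinitely, without an early stopping rule, so that it produces an infinite sequence of iterates. *)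

theory Defs
  imports "HOL-Analysis.Analysis"
begin

definition fw_objective :: "real ^ 'k \<Rightarrow> real ^ 'k \<Rightarrow> real" where
  "fw_objective x y = 1 / 2 * (norm (y - x))\<^sup>2"

lemma GDERIV_fw_objective: "GDERIV (fw_objective x) y :> y - x"
  unfolding gderiv_def fw_objective_def power2_norm_eq_inner
  by (auto intro!: derivative_eq_intros simp: inner_commute algebra_simps)

text \<open>The maximum over \<open>P\<close> is written as a supremum; it is attained for the nonempty
  polytopes considered here (lemma \<open>fw_gap_is_max\<close>). The vector \<open>y - x\<close> is the gradient of
  the objective at \<open>y\<close> (lemma \<open>GDERIV_fw_objective\<close>).\<close>

definition fw_gap :: "(real ^ 'k) set \<Rightarrow> real ^ 'k \<Rightarrow> real ^ 'k \<Rightarrow> real" where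
  "fw_gap P x y = (SUP v\<in>P. (y - x) \<bullet> (y - v))"

lemma fw_gap_is_max:
  assumes "polytope P" "P \<noteq> {}"
  shows "\<exists>v\<in>P. fw_gap P x y = (y - x) \<bullet> (y - v) \<and> (\<forall>w\<in>P. (y - x) \<bullet> (y - w) \<le> fw_gap P x y)"
proof -
  have "continuous_on P (\<lambda>v. (y - x) \<bullet> (y - v))"
    by (intro continuous_intros)
  then obtain v where v: "v \<in> P" "\<And>w. w \<in> P \<Longrightarrow> (y - x) \<bullet> (y - w) \<le> (y - x) \<bullet> (y - v)"
    using continuous_attains_sup[OF polytope_imp_compact[OF assms(1)] assms(2)] by blast
  have "fw_gap P x y = (y - x) \<bullet> (y - v)"
    unfolding fw_gap_def by (rule cSup_eq_maximum) (use v in auto)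
  with v show ?thesis by auto
qed

text \<open>The properties of the iterates of a Frank-Wolfe method that do not depend on the
  variant (step-size rule, away steps, lazification).\<close>

definition fw_iterates :: "(real ^ 'k) set \<Rightarrow> real ^ 'k \<Rightarrow> (nat \<Rightarrow> real ^ 'k) \<Rightarrow> bool" where
  "fw_iterates P x y \<longleftrightarrow> (\<forall>t. y t \<in> P) \<and> (\<lambda>t. fw_gap P x (y t)) \<longlonglongrightarrow> 0"

end

theory Submission imports Defs begin

text \<open>
  Expanding \<open>x - v = (x - y) + (y - v)\<close> turns both certificates into the same condition at a
  point \<open>v\<close>: being closer to \<open>y\<close> than to \<open>x\<close> means
  \<open>(y - x) \<bullet> (y - v) < 1/2 * (norm (x - y))\<^sup>2\<close>, so the points with this property form an open
  halfspace (empty if \<open>x = y\<close>) that does not contain \<open>x\<close> (lemma \<open>closer_iff_inner\<close>). The gap certificate puts the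
  maximiser, hence all of \<open>P\<close>, into this halfspace; the distance certificate puts the vertices
  there, which by convexity and Krein--Milman is again all of \<open>P\<close> (lemma
  \<open>distance_certificate_imp_not_in\<close>). Either way \<open>x\<close> is not in \<open>P\<close>. Conversely, if \<open>x\<close> is
  outside the closed set \<open>P\<close>, then \<open>norm (x - y t)\<close> is bounded below by the positive distance
  of \<open>x\<close> from \<open>P\<close>, whereas the gaps tend to 0.
\<close>

lemma closer_iff_inner:
  fixes x y v :: "'a::real_inner"
  shows "norm (y - v) < norm (x - v) \<longleftrightarrow> (y - x) \<bullet> (y - v) < 1 / 2 * (norm (x - y))\<^sup>2"
proof -
  have "norm (y - v) < norm (x - v) \<longleftrightarrow> (norm (y - v))\<^sup>2 < (norm (x - v))\<^sup>2"
    by (meson norm_ge_zero power2_less_imp_less power_strict_mono zero_less_numeral)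
  also have "(norm (x - v))\<^sup>2 = (norm (y - v))\<^sup>2 + (norm (x - y))\<^sup>2 - 2 * ((y - x) \<bullet> (y - v))"
    by (simp add: power2_norm_eq_inner inner_diff_left inner_diff_right inner_commute)
  finally show ?thesis by auto
qed

text \<open>The points closer to \<open>y\<close> than to \<open>x\<close> form a convex set, so it suffices to test extreme
  points.\<close>

lemma distance_certificate_imp_not_in:
  fixes P :: "'a::euclidean_space set"
  assumes "compact P" "convex P"
    and closer: "\<And>v. v extreme_point_of P \<Longrightarrow> norm (y - v) < norm (x - v)"
  shows "x \<notin> P"
proof
  assume "x \<in> P"
  define H where "H = {v. norm (y - v) < norm (x - v)}"
  have "H = {v. (y - x) \<bullet> v > (y - x) \<bullet> y - 1 / 2 * (norm (x - y))\<^sup>2}"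
    unfolding H_def closer_iff_inner by (auto simp: inner_diff_right)
  then have "convex H"
    by (simp only: convex_halfspace_gt)
  then have "convex hull {v. v extreme_point_of P} \<subseteq> H"
    using closer by (intro hull_minimal) (auto simp: H_def)
  then have "x \<in> H"
    using Krein_Milman_Minkowski[OF assms(1,2)] \<open>x \<in> P\<close> by blast
  then show False by (simp add: H_def)
qed

lemma gap_certificate_imp_closer:
  assumes "polytope P" "v \<in> P" and "fw_gap P x y < 1 / 2 * (norm (x - y))\<^sup>2"
  shows "norm (y - v) < norm (x - v)"
proof -
  have "(y - x) \<bullet> (y - v) \<le> fw_gap P x y"
    using fw_gap_is_max[of P x y] assms by blast
  then show ?thesis
    using assms(3) by (simp add: closer_iff_inner)
qed

lemma not_in_imp_gap_certificate:
  assumes "closed P" "fw_iterates P x y" "x \<notin> P"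
  shows "\<exists>t. fw_gap P x (y t) < 1 / 2 * (norm (x - y t))\<^sup>2"
proof -
  obtain d where d: "d > 0" "\<And>p. p \<in> P \<Longrightarrow> d \<le> dist x p"
    using separate_point_closed[OF assms(1,3)] by blast
  have "(\<lambda>t. fw_gap P x (y t)) \<longlonglongrightarrow> 0" and y: "\<And>t. y t \<in> P"
    using assms(2) by (auto simp: fw_iterates_def)
  then have "\<forall>\<^sub>F t in sequentially. fw_gap P x (y t) < 1 / 2 * d\<^sup>2"
    using d(1) by (intro order_tendstoD) auto
  then obtain t where "fw_gap P x (y t) < 1 / 2 * d\<^sup>2"
    by (auto simp: eventually_sequentially)
  moreover have "d\<^sup>2 \<le> (norm (x - y t))\<^sup>2"
    using d y by (intro power_mono) (auto simp: dist_norm)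
  ultimately show ?thesis
    by (intro exI[of _ t]) auto
qed

theorem mainTheorem1:
  fixes P :: "(real ^ 'k) set" and x :: "real ^ 'k" and y :: "nat \<Rightarrow> real ^ 'k"
  assumes "polytope P" and "P \<noteq> {}"
    and "fw_iterates P x y"
  shows "(x \<notin> P \<longleftrightarrow> (\<exists>t. \<forall>v. v extreme_point_of P \<longrightarrow> norm (y t - v) < norm (x - v)))
    \<and> (x \<notin> P \<longleftrightarrow> (\<exists>t. fw_gap P x (y t) < 1 / 2 * (norm (x - y t))\<^sup>2))"
    (is "(_ \<longleftrightarrow> ?dist) \<and> (_ \<longleftrightarrow> ?gap)")
proof -
  have "x \<notin> P \<Longrightarrow> ?gap"
    using not_in_imp_gap_certificate[OF polytope_imp_closed] assms by blast
  moreover have "?gap \<Longrightarrow> ?dist"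
    using gap_certificate_imp_closer[OF assms(1)] unfolding extreme_point_of_def by blast
  moreover have "?dist \<Longrightarrow> x \<notin> P"
    using distance_certificate_imp_not_in[OF polytope_imp_compact polytope_imp_convex] assms(1)
    by blast
  ultimately show ?thesis by blast
qed

end
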